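(* Let $p\in\mathbb R\setminus\{-\tfrac12,-1,-\tfrac32,-2,\dots\}$, let $P\in\mathbb R^{2\times 2}$ and $\psi\in\mathbb R$, and let $(\alpha_n)_{n\in\mathbb N_0}$ and $(\beta_n)_{n\in\mathbb N_0}$ be sequences of real numbers. Then the following statements are equivalent. (i) $(\alpha_0,\beta_0)=(1,0)$ and for all $n\in\mathbb N_0$ $$(\alpha_{n+1},\beta_{n+1})=(\alpha_n,\beta_n)\cdot\frac{-1}{(n+1)(2p+n+1)}\,P\,J\begin{pmatrix}2p+n+1&0\\ \psi&n+1\end{pmatrix}.$$ (ii) The power series $A(z)=\sum_{n=0}^\infty\alpha_nz^n$ and $B(z)=\sum_{n=0}^\infty\beta_nz^n$ represent entire functions with $A(0)=1$ and $B(0)=0$, and, with the notation $$\big(A(a,z),B(a,z)\big)=\big(a^pA(az),a^pB(az)\big)\,D_\psi(a)^{-1},\qquad a>0,$$ it holds for all $0<a<b<\infty$ (and all $z$) that $$\big(A(b,z),B(b,z)\big)J-\big(A(a,z),B(a,z)\big)J=z\int_a^b\big(A(c,z),B(c,z)\big)H_{P,\psi}(c)\,dc.\qquad( * )$$ (iii) The power series $A(z)=\sum_{n=0}^\infty\alpha_nz^n$ and $B(z)=\sum_{n=0}^\infty\beta_nz^n$ have positive radius of convergence, $A(0)=1$, $B(0)=0$, and there exist $a,b$ with $0<a<b<\infty$ such that the equality $( * )$ holds (for all $z$ in a neighbourhood of $0$, with $A(c,z),B(c,z)$ defined as in (ii)).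
   Context: $\mathbb N_0=\{0,1,2,\dots\}$ and $J=\begin{pmatrix}0&-1\\1&0\end{pmatrix}$. For $a>0$, $D_\psi(a)$ (depending also on $p$) is $$D_\psi(a)=\begin{pmatrix}1&0\\ \frac{\psi}{2p}&1\end{pmatrix}\begin{pmatrix}a^p&0\\0&a^{-p}\end{pmatrix}\begin{pmatrix}1&0\\-\frac{\psi}{2p}&1\end{pmatrix}\ \text{if }p\ne0,\qquad D_\psi(a)=\begin{pmatrix}1&0\\ \psi\log a&1\end{pmatrix}\ \text{if }p=0,$$ and $H_{P,\psi}(a)=D_\psi(a)\,P\,D_\psi(a)^T$. The matrix $P$ is not assumed symmetric. *)

theory Defs
  imports "HOL-Analysis.Analysis"
begin

definition mat22 :: "'a::zero \<Rightarrow> 'a \<Rightarrow> 'a \<Rightarrow> 'a \<Rightarrow> 'a ^ 2 ^ 2" where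
  "mat22 a b c d = vector [vector [a, b], vector [c, d]]"

definition J :: "real ^ 2 ^ 2" where
  "J = mat22 0 (-1) 1 0"

definition cmat :: "real ^ 2 ^ 2 \<Rightarrow> complex ^ 2 ^ 2" where
  "cmat M = map_matrix complex_of_real M"

text \<open>The two functions below are meaningful for \<open>a > 0\<close> only.\<close>

definition D :: "real \<Rightarrow> real \<Rightarrow> real \<Rightarrow> real ^ 2 ^ 2" where
  "D p \<psi> a =
    (if p \<noteq> 0
     then mat22 1 0 (\<psi> / (2 * p)) 1 ** mat22 (a powr p) 0 0 (a powr (- p)) **
          mat22 1 0 (- \<psi> / (2 * p)) 1
     else mat22 1 0 (\<psi> * ln a) 1)"

definition H :: "real \<Rightarrow> real ^ 2 ^ 2 \<Rightarrow> real \<Rightarrow> real \<Rightarrow> real ^ 2 ^ 2" where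
  "H p P \<psi> a = D p \<psi> a ** P ** transpose (D p \<psi> a)"

definition pseries :: "(nat \<Rightarrow> real) \<Rightarrow> complex \<Rightarrow> complex" where
  "pseries \<alpha> z = (\<Sum>n. complex_of_real (\<alpha> n) * z ^ n)"

definition represents_entire :: "(nat \<Rightarrow> real) \<Rightarrow> bool" where
  "represents_entire \<alpha> \<longleftrightarrow>
    (\<forall>z::complex. summable (\<lambda>n. complex_of_real (\<alpha> n) * z ^ n)) \<and>
    pseries \<alpha> holomorphic_on UNIV"

text \<open>The row vector \<open>(A(a,z), B(a,z))\<close>.\<close>

definition AB ::
  "real \<Rightarrow> real \<Rightarrow> (nat \<Rightarrow> real) \<Rightarrow> (nat \<Rightarrow> real) \<Rightarrow> real \<Rightarrow> complex \<Rightarrow> complex ^ 2" where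
  "AB p \<psi> \<alpha> \<beta> a z =
    vector [complex_of_real (a powr p) * pseries \<alpha> (complex_of_real a * z),
            complex_of_real (a powr p) * pseries \<beta> (complex_of_real a * z)]
      v* cmat (matrix_inv (D p \<psi> a))"

text \<open>
  The integral equation between \<open>a\<close> and \<open>b\<close>. The integrand is continuous on \<open>{a..b}\<close> whenever
  \<open>0 < a\<close> and \<open>b * norm z\<close> is less than both radii of convergence, so there the
  Henstock--Kurzweil integral is the ordinary componentwise one.
\<close>

definition integral_eq ::
  "real \<Rightarrow> real ^ 2 ^ 2 \<Rightarrow> real \<Rightarrow> (nat \<Rightarrow> real) \<Rightarrow> (nat \<Rightarrow> real) \<Rightarrow>
    real \<Rightarrow> real \<Rightarrow> complex \<Rightarrow> bool" where
  "integral_eq p P \<psi> \<alpha> \<beta> a b z \<longleftrightarrow>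
    AB p \<psi> \<alpha> \<beta> b z v* cmat J - AB p \<psi> \<alpha> \<beta> a z v* cmat J =
    z *s integral {a..b} (\<lambda>c. AB p \<psi> \<alpha> \<beta> c z v* cmat (H p P \<psi> c))"

end

theory Submission
  imports Defs
begin

text \<open>
  Applying one step of the recursion in (i) to arbitrary coefficient sequences \<open>(\<alpha>, \<beta>)\<close> gives
  sequences \<open>(\<alpha>', \<beta>')\<close> whose power series satisfy a first-order linear differential equation with
  inhomogeneity \<open>(A, B) P\<close>. By this equation \<open>c \<mapsto> (A'(c,z), B'(c,z)) J\<close> is an antiderivative of \<open>z\<close> times
  the integrand of \<open>(*)\<close>, so \<open>(*)\<close> says precisely that the two sequences give the same increment of
  \<open>(A(c,z), B(c,z)) J\<close> between \<open>a\<close> and \<open>b\<close>, and no interchange of sum and integral is needed. As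
  \<open>b\<close> to the power \<open>2 p + n\<close> differs from \<open>a\<close> to the same power for \<open>n \<ge> 1\<close>, comparing the coefficients
  of \<open>z\<close>, first for \<open>\<beta>\<close> and then for \<open>\<alpha>\<close>, shows \<open>(\<alpha>', \<beta>') = (\<alpha>, \<beta>)\<close>, which is (i).
\<close>

section \<open>Two-by-two matrices and closed forms of \<open>D\<close>, \<open>AB\<close> and
  \<open>H\<close>\<close>

lemma vec2_eq_iff: "(x :: 'a ^ 2) = y \<longleftrightarrow> x $ 1 = y $ 1 \<and> x $ 2 = y $ 2"
  by (simp add: vec_eq_iff forall_2)

lemma mat22_nth [simp]:
  "mat22 a b c d $ 1 $ 1 = a" "mat22 a b c d $ 1 $ 2 = b"
  "mat22 a b c d $ 2 $ 1 = c" "mat22 a b c d $ 2 $ 2 = d"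
  by (simp_all add: mat22_def)

lemma cmat_nth [simp]: "cmat M $ i $ j = complex_of_real (M $ i $ j)"
  by (simp add: cmat_def map_matrix_def)

lemmas mat2_simps = vec2_eq_iff vector_matrix_mult_def matrix_matrix_mult_def transpose_def sum_2

text \<open>For a > 0 this is the integral of \<psi> c^(2p-1) over c from 1 to a, and also a^p times
  the lower left entry of \<open>D\<close>. It treats the cases p = 0 and p \<noteq> 0 of
  \<open>D\<close> together.\<close>

definition shear :: "real \<Rightarrow> real \<Rightarrow> real \<Rightarrow> real" where
  "shear p \<psi> a = (if p \<noteq> 0 then \<psi> * (a powr (2 * p) - 1) / (2 * p) else \<psi> * ln a)"

lemma powr_double: "(a::real) powr (2 * p) = a powr p * a powr p" "a powr (p * 2) = a powr p * a powr p"
  by (simp_all add: powr_add [symmetric] mult.commute)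

text \<open>Clearing the denominator 2p removes the case distinction: for p = 0 both sides
  vanish.\<close>

lemma two_p_shear: "a > 0 \<Longrightarrow> 2 * p * shear p \<psi> a = \<psi> * a powr (2 * p) - \<psi>"
  by (cases "p = 0") (simp_all add: shear_def divide_simps algebra_simps)

lemma shear_deriv:
  assumes "a > 0"
  shows "(shear p \<psi> has_real_derivative \<psi> * a powr (2 * p) / a) (at a)"
proof (cases "p = 0")
  case True
  then have "shear p \<psi> = (\<lambda>a. \<psi> * ln a)"
    by (simp add: shear_def fun_eq_iff)
  with True assms show ?thesis
    by (auto intro!: derivative_eq_intros)
next
  case False
  then have "shear p \<psi> = (\<lambda>a. \<psi> * (a powr (2 * p) - 1) / (2 * p))"
    by (simp add: shear_def fun_eq_iff)
  with False assms show ?thesis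
    by (auto intro!: derivative_eq_intros simp: powr_diff)
qed

lemma D_eq:
  assumes "a > 0"
  shows "D p \<psi> a = mat22 (a powr p) 0 (shear p \<psi> a / a powr p) (1 / a powr p)"
proof -
  have "a powr p \<noteq> 0"
    using assms by simp
  then show ?thesis
    by (auto simp: D_def shear_def mat2_simps powr_minus powr_double divide_simps right_diff_distrib)
qed

lemma matrix_inv_unique:
  fixes A B :: "'a::semiring_1 ^ 'n ^ 'n"
  assumes "A ** B = mat 1" "B ** A = mat 1"
  shows "matrix_inv A = B"
proof -
  have "A ** matrix_inv A = mat 1 \<and> matrix_inv A ** A = mat 1"
    unfolding matrix_inv_def by (rule someI [of _ B]) (use assms in simp)
  then have "B = (B ** A) ** matrix_inv A"
    by (simp add: matrix_mul_assoc [symmetric])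
  with assms show ?thesis by simp
qed

text \<open>\<open>D\<close> has determinant 1, so its inverse is the adjugate.\<close>

lemma matrix_inv_D:
  assumes "a > 0"
  shows "matrix_inv (D p \<psi> a) = mat22 (1 / a powr p) 0 (- shear p \<psi> a / a powr p) (a powr p)"
proof (rule matrix_inv_unique)
  have nz: "a powr p \<noteq> 0"
    using assms by simp
  show "D p \<psi> a ** mat22 (1 / a powr p) 0 (- shear p \<psi> a / a powr p) (a powr p) = mat 1"
    using nz by (simp add: D_eq assms mat2_simps mat_def)
  show "mat22 (1 / a powr p) 0 (- shear p \<psi> a / a powr p) (a powr p) ** D p \<psi> a = mat 1"
    using nz by (simp add: D_eq assms mat2_simps mat_def)
qed

lemma AB_eq:
  assumes "a > 0"
  shows "AB p \<psi> \<alpha> \<beta> a z =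
    vector [pseries \<alpha> (a * z) - shear p \<psi> a * pseries \<beta> (a * z),
            of_real (a powr (2 * p)) * pseries \<beta> (a * z)]"
proof -
  have "a powr p \<noteq> 0"
    using assms by simp
  then show ?thesis
    by (simp add: AB_def matrix_inv_D assms mat2_simps powr_double field_simps)
qed

lemma AB_J:
  assumes "a > 0"
  shows "AB p \<psi> \<alpha> \<beta> a z v* cmat J =
    vector [of_real (a powr (2 * p)) * pseries \<beta> (a * z),
            shear p \<psi> a * pseries \<beta> (a * z) - pseries \<alpha> (a * z)]"
  using assms by (simp add: AB_eq J_def mat2_simps)

text \<open>The factor D^(-1) in \<open>AB\<close> cancels the left factor D of \<open>H\<close>,
  which leaves a^p (A, B) P D^T; \<open>U\<close> is the row vector (A, B) P.\<close>

lemma AB_H: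
  fixes a :: real and z :: complex and U :: "2 \<Rightarrow> complex"
    and \<alpha> \<beta> :: "nat \<Rightarrow> real" and P :: "real ^ 2 ^ 2"
  assumes "a > 0"
  defines "U \<equiv> \<lambda>j. P $ 1 $ j * pseries \<alpha> (a * z) + P $ 2 $ j * pseries \<beta> (a * z)"
  shows "AB p \<psi> \<alpha> \<beta> a z v* cmat (H p P \<psi> a) =
    vector [of_real (a powr (2 * p)) * U 1, shear p \<psi> a * U 1 + U 2]"
proof -
  have "a powr p \<noteq> 0"
    using assms by simp
  then show ?thesis
    by (simp add: AB_eq U_def H_def D_eq assms mat2_simps powr_double field_simps)
qed

section \<open>Componentwise integration, and power series as formal power series\<close>

lemma vector2_axis: "(vector [x, y] :: complex ^ 2) = axis 1 x + axis 2 y"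
  by (simp add: vec2_eq_iff axis_def)

lemma bounded_linear_axis: "bounded_linear (axis i :: 'a::euclidean_space \<Rightarrow> 'a ^ 'n)"
  unfolding linear_conv_bounded_linear [symmetric]
  by (rule linearI) (auto simp: axis_def vec_eq_iff)

text \<open>The two coordinate embeddings are bounded linear and so commute with
  integration.\<close>

lemma has_integral_vector2:
  assumes "(f has_integral x) S" "(g has_integral y) S"
  shows "((\<lambda>c. vector [f c, g c] :: complex ^ 2) has_integral vector [x, y]) S"
  unfolding vector2_axis
  using assms [THEN has_integral_linear, OF bounded_linear_axis]
  by (intro has_integral_add) (simp_all add: o_def)

abbreviation cfps :: "(nat \<Rightarrow> real) \<Rightarrow> complex fps" where
  "cfps \<alpha> \<equiv> Abs_fps (\<lambda>n. complex_of_real (\<alpha> n))"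

lemma pseries_eq_eval_fps: "pseries \<alpha> = eval_fps (cfps \<alpha>)"
  by (simp add: pseries_def eval_fps_def fun_eq_iff)

lemma pseries_0 [simp]: "pseries \<alpha> 0 = complex_of_real (\<alpha> 0)"
  by (simp add: pseries_eq_eval_fps eval_fps_at_0)

text \<open>Convergence at every point forces an infinite radius, and a power series is holomorphic
  inside its disc of convergence.\<close>

lemma represents_entire_iff: "represents_entire \<alpha> \<longleftrightarrow> fps_conv_radius (cfps \<alpha>) = \<infinity>"
proof
  assume "represents_entire \<alpha>"
  then show "fps_conv_radius (cfps \<alpha>) = \<infinity>"
    unfolding fps_conv_radius_def represents_entire_def
    by (intro conv_radius_inftyI'') simp
next
  assume *: "fps_conv_radius (cfps \<alpha>) = \<infinity>"
  then show "represents_entire \<alpha>"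
    using holomorphic_on_eval_fps [of UNIV "cfps \<alpha>"] summable_fps [of _ "cfps \<alpha>"]
    by (auto simp: represents_entire_def pseries_eq_eval_fps)
qed

section \<open>One step of the recursion as a map on pairs of sequences\<close>

definition step\<^sub>B :: "real \<Rightarrow> real ^ 2 ^ 2 \<Rightarrow> (nat \<Rightarrow> real) \<Rightarrow> (nat \<Rightarrow> real) \<Rightarrow> nat \<Rightarrow> real" where
  "step\<^sub>B p P \<alpha> \<beta> n = (case n of 0 \<Rightarrow> 0
     | Suc m \<Rightarrow> (\<alpha> m * P $ 1 $ 1 + \<beta> m * P $ 2 $ 1) / (2 * p + real n))"

text \<open>Here n is the new index, so the divisors are 2p + n in \<open>step\<^sub>B\<close> and n
  in \<open>step\<^sub>A\<close>. The values 0 and 1 at index 0 are the initial data of (i), which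
  turns (i) into a fixed-point equation.\<close>

definition step\<^sub>A ::
  "real \<Rightarrow> real ^ 2 ^ 2 \<Rightarrow> real \<Rightarrow> (nat \<Rightarrow> real) \<Rightarrow> (nat \<Rightarrow> real) \<Rightarrow> nat \<Rightarrow> real" where
  "step\<^sub>A p P \<psi> \<alpha> \<beta> n = (case n of 0 \<Rightarrow> 1
     | Suc m \<Rightarrow> (\<psi> * step\<^sub>B p P \<alpha> \<beta> n - (\<alpha> m * P $ 1 $ 2 + \<beta> m * P $ 2 $ 2)) / real n)"

text \<open>This makes the divisions in \<open>step\<^sub>B\<close> genuine and later separates
  a^(2p+n) from b^(2p+n).\<close>

definition nonresonant :: "real \<Rightarrow> bool" where
  "nonresonant p \<longleftrightarrow> (\<forall>n. 2 * p + real (Suc n) \<noteq> 0)"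

lemma nonresonantI: "p \<notin> {- (real k / 2) | k. k \<ge> 1} \<Longrightarrow> nonresonant p"
proof (unfold nonresonant_def, rule allI, rule notI)
  fix n
  assume *: "p \<notin> {- (real k / 2) | k. k \<ge> 1}" and "2 * p + real (Suc n) = 0"
  moreover have "2 * p + x = 0 \<Longrightarrow> p = - (x / 2)" for x by linarith
  ultimately have "p = - (real (Suc n) / 2)" by blast
  then have "p \<in> {- (real k / 2) | k. k \<ge> 1}" by (intro CollectI exI [of _ "Suc n"]) simp
  with * show False by blast
qed

lemma recursion_iff:
  assumes "nonresonant p"
  shows "((\<alpha> 0, \<beta> 0) = (1, 0) \<and>
      (\<forall>n. (vector [\<alpha> (n + 1), \<beta> (n + 1)] :: real ^ 2) =
        vector [\<alpha> n, \<beta> n] v*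
          ((- 1 / ((real n + 1) * (2 * p + real n + 1))) *\<^sub>R
            (P ** J ** mat22 (2 * p + real n + 1) 0 \<psi> (real n + 1))))) \<longleftrightarrow>
    \<alpha> = step\<^sub>A p P \<psi> \<alpha> \<beta> \<and> \<beta> = step\<^sub>B p P \<alpha> \<beta>"
    (is "?init \<and> (\<forall>n. ?rec n) \<longleftrightarrow> _")
proof -
  have step: "?rec n \<longleftrightarrow> \<alpha> (Suc n) = step\<^sub>A p P \<psi> \<alpha> \<beta> (Suc n) \<and> \<beta> (Suc n) = step\<^sub>B p P \<alpha> \<beta> (Suc n)"
    for n
  proof -
    define s where "s = 2 * p + real (Suc n)"
    define m where "m = real (Suc n)"
    have nz: "s \<noteq> 0" "m \<noteq> 0"
      using assms unfolding nonresonant_def s_def m_def by (blast, simp)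
    have eqs: "2 * p + real n + 1 = s" "real n + 1 = m" "n + 1 = Suc n"
      by (simp_all add: s_def m_def)
    let ?v = "vector [\<alpha> n, \<beta> n] v* ((- 1 / (m * s)) *\<^sub>R (P ** J ** mat22 s 0 \<psi> m)) :: real ^ 2"
    let ?u = "\<lambda>j. \<alpha> n * P $ 1 $ j + \<beta> n * P $ 2 $ j"
    \<comment> \<open>With (u1, u2) = (\<alpha> n, \<beta> n) P one has (u1, u2) J = (u2, -u1), and
      the last matrix gives (s u2 - \<psi> u1, -m u1), still to be multiplied by -1/(m s).\<close>
    have "?v $ 1 = (\<psi> * (?u 1 / s) - ?u 2) / m" "?v $ 2 = ?u 1 / s"
      using nz by (simp_all add: mat2_simps J_def) (simp_all add: field_simps)
    then show ?thesis
      unfolding eqs step\<^sub>A_def step\<^sub>B_def nat.case s_def [symmetric]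
      unfolding m_def [symmetric] vec2_eq_iff vector_2 by simp
  qed
  have all: "f = g \<longleftrightarrow> f 0 = g 0 \<and> (\<forall>n. f (Suc n) = g (Suc n))" for f g :: "nat \<Rightarrow> real"
    unfolding fun_eq_iff by (metis nat.exhaust)
  show ?thesis
    unfolding step all [of \<alpha>] all [of \<beta>] by (auto simp: step\<^sub>A_def step\<^sub>B_def)
qed

lemma step\<^sub>B_Suc:
  assumes "nonresonant p"
  shows "(2 * p + real (Suc n)) * step\<^sub>B p P \<alpha> \<beta> (Suc n) = \<alpha> n * P $ 1 $ 1 + \<beta> n * P $ 2 $ 1"
proof -
  have "2 * p + real (Suc n) \<noteq> 0"
    using assms unfolding nonresonant_def by blast
  then show ?thesis
    by (simp add: step\<^sub>B_def del: of_nat_Suc)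
qed

lemma step\<^sub>A_Suc:
  "real (Suc n) * step\<^sub>A p P \<psi> \<alpha> \<beta> (Suc n) =
    \<psi> * step\<^sub>B p P \<alpha> \<beta> (Suc n) - (\<alpha> n * P $ 1 $ 2 + \<beta> n * P $ 2 $ 2)"
  by (simp add: step\<^sub>A_def del: of_nat_Suc)

section \<open>Growth estimates and radii of convergence\<close>

lemma step_bound:
  obtains C N where "C \<ge> 0"
    "\<And>n. n \<ge> N \<Longrightarrow> \<bar>step\<^sub>A p P \<psi> \<alpha> \<beta> (Suc n)\<bar> \<le> C / real (Suc n) * (\<bar>\<alpha> n\<bar> + \<bar>\<beta> n\<bar>)"
    "\<And>n. n \<ge> N \<Longrightarrow> \<bar>step\<^sub>B p P \<alpha> \<beta> (Suc n)\<bar> \<le> C / real (Suc n) * (\<bar>\<alpha> n\<bar> + \<bar>\<beta> n\<bar>)"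
proof -
  define K where "K = 1 + \<bar>P $ 1 $ 1\<bar> + \<bar>P $ 2 $ 1\<bar> + \<bar>P $ 1 $ 2\<bar> + \<bar>P $ 2 $ 2\<bar>"
  \<comment> \<open>This constant dominates both 2K, needed for \<open>step\<^sub>B\<close>, and K +
    2K|\<psi>|, needed for \<open>step\<^sub>A\<close>.\<close>
  define C where "C = 2 * K * (1 + \<bar>\<psi>\<bar>)"
  \<comment> \<open>From this index on |2p| is at most n/2, so |2p + n + 1| is at least (n +
    1)/2.\<close>
  define N where "N = nat \<lceil>4 * \<bar>p\<bar>\<rceil>"
  have K: "\<bar>x * P $ 1 $ j + y * P $ 2 $ j\<bar> \<le> K * (\<bar>x\<bar> + \<bar>y\<bar>)" for x y :: real and j :: 2
  proof -
    have "\<bar>P $ 1 $ j\<bar> \<le> K" "\<bar>P $ 2 $ j\<bar> \<le> K"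
      using exhaust_2 [of j] by (auto simp: K_def)
    then have "\<bar>x\<bar> * \<bar>P $ 1 $ j\<bar> + \<bar>y\<bar> * \<bar>P $ 2 $ j\<bar> \<le> \<bar>x\<bar> * K + \<bar>y\<bar> * K"
      by (intro add_mono mult_left_mono) auto
    then show ?thesis
      using abs_triangle_ineq [of "x * P $ 1 $ j" "y * P $ 2 $ j"]
      by (simp add: abs_mult algebra_simps)
  qed
  have "K \<ge> 0" by (simp add: K_def)
  have B: "\<bar>step\<^sub>B p P \<alpha> \<beta> (Suc n)\<bar> \<le> 2 * K / real (Suc n) * (\<bar>\<alpha> n\<bar> + \<bar>\<beta> n\<bar>)" if "n \<ge> N" for n
  proof -
    have "4 * \<bar>p\<bar> \<le> real n" using that by (simp add: N_def nat_le_iff ceiling_le_iff)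
    then have *: "real (Suc n) / 2 \<le> \<bar>2 * p + real (Suc n)\<bar>" by simp
    have "\<bar>step\<^sub>B p P \<alpha> \<beta> (Suc n)\<bar> \<le> (K * (\<bar>\<alpha> n\<bar> + \<bar>\<beta> n\<bar>)) / (real (Suc n) / 2)"
      unfolding step\<^sub>B_def nat.case abs_divide
      by (rule frac_le [OF _ K _ *]) (use \<open>K \<ge> 0\<close> in auto)
    then show ?thesis by (simp add: field_simps)
  qed
  have B': "2 * K / real (Suc n) * (\<bar>\<alpha> n\<bar> + \<bar>\<beta> n\<bar>) \<le> C / real (Suc n) * (\<bar>\<alpha> n\<bar> + \<bar>\<beta> n\<bar>)" for n
    using \<open>K \<ge> 0\<close> by (intro mult_right_mono divide_right_mono) (auto simp: C_def algebra_simps)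
  have A: "\<bar>step\<^sub>A p P \<psi> \<alpha> \<beta> (Suc n)\<bar> \<le> C / real (Suc n) * (\<bar>\<alpha> n\<bar> + \<bar>\<beta> n\<bar>)" if "n \<ge> N" for n
  proof -
    let ?s = "\<bar>\<alpha> n\<bar> + \<bar>\<beta> n\<bar>" and ?B = "step\<^sub>B p P \<alpha> \<beta> (Suc n)"
    \<comment> \<open>The decay 1/(n+1) of \<open>?B\<close> is given up here; the division by n + 1
      in \<open>step\<^sub>A\<close> supplies it again.\<close>
    have "2 * K / real (Suc n) * ?s \<le> 2 * K / 1 * ?s"
      using \<open>K \<ge> 0\<close> by (intro mult_right_mono divide_left_mono) auto
    with B [OF that] have "\<bar>?B\<bar> \<le> 2 * K * ?s" by linarith
    then have "\<bar>\<psi>\<bar> * \<bar>?B\<bar> \<le> \<bar>\<psi>\<bar> * (2 * K * ?s)"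
      by (rule mult_left_mono) simp
    then have "\<bar>\<psi> * ?B - (\<alpha> n * P $ 1 $ 2 + \<beta> n * P $ 2 $ 2)\<bar> \<le> \<bar>\<psi>\<bar> * (2 * K * ?s) + K * ?s"
      using K [of "\<alpha> n" 2 "\<beta> n"] abs_triangle_ineq4 [of "\<psi> * ?B" "\<alpha> n * P $ 1 $ 2 + \<beta> n * P $ 2 $ 2"]
      unfolding abs_mult by linarith
    also have "\<dots> \<le> C * ?s"
      using \<open>K \<ge> 0\<close> by (simp add: C_def algebra_simps)
    finally show ?thesis
      unfolding step\<^sub>A_def nat.case abs_divide by (simp add: divide_right_mono)
  qed
  show thesis
  proof (rule that)
    show "C \<ge> 0" using \<open>K \<ge> 0\<close> by (simp add: C_def)
  qed (use A B B' order.trans in blast)+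
qed

text \<open>After multiplication by r^(n+1) the bound compares the terms of \<gamma> with C r times
  those of \<alpha> and \<beta>, one index lower. In the implication from (iii) to (i) it serves for
  a single step, when \<alpha> and \<beta> are not yet known to satisfy the recursion.\<close>

lemma fps_conv_radius_geI:
  assumes "\<And>n. n \<ge> N \<Longrightarrow> \<bar>\<gamma> (Suc n)\<bar> \<le> C / real (Suc n) * (\<bar>\<alpha> n\<bar> + \<bar>\<beta> n\<bar>)" and "C \<ge> 0"
  shows "min (fps_conv_radius (cfps \<alpha>)) (fps_conv_radius (cfps \<beta>)) \<le> fps_conv_radius (cfps \<gamma>)"
proof -
  have "summable (\<lambda>n. complex_of_real (\<gamma> n) * of_real r ^ n)"
    if "0 < r" "ereal r < min (fps_conv_radius (cfps \<alpha>)) (fps_conv_radius (cfps \<beta>))" for r :: real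
  proof -
    have "summable (\<lambda>n. \<bar>\<alpha> n\<bar> * r ^ n)" "summable (\<lambda>n. \<bar>\<beta> n\<bar> * r ^ n)"
      using that norm_summable_fps [of "complex_of_real r" "cfps \<alpha>"]
        norm_summable_fps [of "complex_of_real r" "cfps \<beta>"]
      by (simp_all add: norm_mult norm_power)
    then have "summable (\<lambda>n. C * r * (\<bar>\<alpha> n\<bar> * r ^ n + \<bar>\<beta> n\<bar> * r ^ n))"
      by (intro summable_mult summable_add)
    moreover have "norm (complex_of_real (\<gamma> (Suc n)) * of_real r ^ Suc n)
        \<le> C * r * (\<bar>\<alpha> n\<bar> * r ^ n + \<bar>\<beta> n\<bar> * r ^ n)" if "n \<ge> N" for n
    proof -
      have "C / real (Suc n) * (\<bar>\<alpha> n\<bar> + \<bar>\<beta> n\<bar>) \<le> C / 1 * (\<bar>\<alpha> n\<bar> + \<bar>\<beta> n\<bar>)"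
        using \<open>C \<ge> 0\<close> by (intro mult_right_mono divide_left_mono) auto
      with assms(1) [OF that] have "\<bar>\<gamma> (Suc n)\<bar> \<le> C * (\<bar>\<alpha> n\<bar> + \<bar>\<beta> n\<bar>)" by linarith
      then have "\<bar>\<gamma> (Suc n)\<bar> * r ^ Suc n \<le> C * (\<bar>\<alpha> n\<bar> + \<bar>\<beta> n\<bar>) * r ^ Suc n"
        using \<open>0 < r\<close> by (intro mult_right_mono) auto
      then show ?thesis
        using \<open>0 < r\<close> by (simp add: norm_mult norm_power algebra_simps)
    qed
    ultimately have "summable (\<lambda>n. complex_of_real (\<gamma> (Suc n)) * of_real r ^ Suc n)"
      by (rule summable_comparison_test')
    then show ?thesis by (subst (asm) summable_Suc_iff)
  qed
  then show ?thesis
    unfolding fps_conv_radius_def [of "cfps \<gamma>"] by (intro conv_radius_geI_ex') simp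
qed

lemma fps_conv_radius_step:
  assumes "norm w < fps_conv_radius (cfps \<alpha>)" "norm w < fps_conv_radius (cfps \<beta>)"
  shows "norm w < fps_conv_radius (cfps (step\<^sub>A p P \<psi> \<alpha> \<beta>))"
    and "norm w < fps_conv_radius (cfps (step\<^sub>B p P \<alpha> \<beta>))"
proof -
  obtain C N where C: "C \<ge> 0"
    and A: "\<And>n. n \<ge> N \<Longrightarrow> \<bar>step\<^sub>A p P \<psi> \<alpha> \<beta> (Suc n)\<bar> \<le> C / real (Suc n) * (\<bar>\<alpha> n\<bar> + \<bar>\<beta> n\<bar>)"
    and B: "\<And>n. n \<ge> N \<Longrightarrow> \<bar>step\<^sub>B p P \<alpha> \<beta> (Suc n)\<bar> \<le> C / real (Suc n) * (\<bar>\<alpha> n\<bar> + \<bar>\<beta> n\<bar>)"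
    using step_bound by metis
  have "norm w < min (fps_conv_radius (cfps \<alpha>)) (fps_conv_radius (cfps \<beta>))"
    using assms by simp
  from less_le_trans [OF this fps_conv_radius_geI [OF A C]]
    less_le_trans [OF this fps_conv_radius_geI [OF B C]]
  show "norm w < fps_conv_radius (cfps (step\<^sub>A p P \<psi> \<alpha> \<beta>))"
    and "norm w < fps_conv_radius (cfps (step\<^sub>B p P \<alpha> \<beta>))"
    by simp_all
qed

text \<open>At a fixed point \<open>step_bound\<close> becomes a coupled recursive estimate. Adding
  its two halves bounds the ratio of successive values of |\<alpha> n| + |\<beta> n| by 2C/(n+1),
  which tends to 0.\<close>

lemma represents_entire_fixed_point:
  assumes \<alpha>: "\<alpha> = step\<^sub>A p P \<psi> \<alpha> \<beta>" and \<beta>: "\<beta> = step\<^sub>B p P \<alpha> \<beta>"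
  shows "represents_entire \<alpha>" "represents_entire \<beta>"
proof -
  obtain C N where C: "C \<ge> 0"
    and A: "\<And>n. n \<ge> N \<Longrightarrow> \<bar>\<alpha> (Suc n)\<bar> \<le> C / real (Suc n) * (\<bar>\<alpha> n\<bar> + \<bar>\<beta> n\<bar>)"
    and B: "\<And>n. n \<ge> N \<Longrightarrow> \<bar>\<beta> (Suc n)\<bar> \<le> C / real (Suc n) * (\<bar>\<alpha> n\<bar> + \<bar>\<beta> n\<bar>)"
    using step_bound [of p P \<psi> \<alpha> \<beta>] unfolding \<alpha> [symmetric] \<beta> [symmetric] by metis
  define s where "s n = \<bar>\<alpha> n\<bar> + \<bar>\<beta> n\<bar>" for n
  have summable: "summable (\<lambda>n. s n * r ^ n)" if "r \<ge> 0" for r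
  proof (rule summable_ratio_test)
    fix n
    \<comment> \<open>The threshold 4 C r makes the ratio 2 C r / (n + 1) at most 1/2.\<close>
    assume n: "n \<ge> max N (nat \<lceil>4 * C * r\<rceil>)"
    then have "4 * C * r \<le> real n" by (simp add: nat_le_iff ceiling_le_iff)
    then have *: "2 * C / real (Suc n) * r \<le> 1 / 2" by (simp add: field_simps)
    have "s (Suc n) \<le> 2 * (C / real (Suc n) * s n)"
      using A [of n] B [of n] n unfolding s_def by linarith
    then have "s (Suc n) \<le> 2 * C / real (Suc n) * s n"
      by simp
    then have "s (Suc n) * r ^ Suc n \<le> (2 * C / real (Suc n) * s n) * r ^ Suc n"
      using that by (intro mult_right_mono) auto
    also have "\<dots> = (2 * C / real (Suc n) * r) * (s n * r ^ n)"
      by simp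
    also have "\<dots> \<le> 1 / 2 * (s n * r ^ n)"
      using that by (intro mult_right_mono *) (simp add: s_def)
    finally show "norm (s (Suc n) * r ^ Suc n) \<le> 1 / 2 * norm (s n * r ^ n)"
      using that by (simp add: s_def abs_mult)
  qed simp
  have "fps_conv_radius (cfps \<gamma>) = \<infinity>" if "\<And>n. \<bar>\<gamma> n\<bar> \<le> s n" for \<gamma>
    unfolding fps_conv_radius_def
  proof (rule conv_radius_inftyI'')
    fix z :: complex
    show "summable (\<lambda>n. fps_nth (cfps \<gamma>) n * z ^ n)"
      by (rule summable_comparison_test' [OF summable [of "norm z"]])
        (auto simp: norm_mult norm_power intro!: mult_right_mono that)
  qed
  then show "represents_entire \<alpha>" "represents_entire \<beta>"
    by (simp_all add: represents_entire_iff s_def)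
qed

section \<open>The differential equations and the integral equation for one step\<close>

lemma eval_fps_const_mult:
  fixes f :: "complex fps"
  assumes "norm w < fps_conv_radius f"
  shows "norm w < fps_conv_radius (fps_const c * f)"
    and "eval_fps (fps_const c * f) w = c * eval_fps f w"
  using assms fps_conv_radius_mult [of "fps_const c" f] eval_fps_mult [of w "fps_const c" f]
  by (auto intro: less_le_trans)

lemma eval_fps_X_mult:
  fixes f :: "complex fps"
  assumes "norm w < fps_conv_radius f"
  shows "norm w < fps_conv_radius (fps_X * f)"
    and "eval_fps (fps_X * f) w = w * eval_fps f w"
  using assms fps_conv_radius_mult [of fps_X f] eval_fps_mult [of w fps_X f]
  by (auto intro: less_le_trans)

lemma fps_conv_radius_add_less:
  fixes f :: "complex fps"
  assumes "norm w < fps_conv_radius f" "norm w < fps_conv_radius g"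
  shows "norm w < fps_conv_radius (f + g)"
  by (rule less_le_trans [OF _ fps_conv_radius_add]) (use assms in simp)

lemma fps_conv_radius_deriv_less:
  fixes f :: "complex fps"
  assumes "norm w < fps_conv_radius f"
  shows "norm w < fps_conv_radius (fps_deriv f)"
  using assms fps_conv_radius_deriv [of f] by (auto intro: less_le_trans)

lemmas eval_fps_rules = eval_fps_const_mult eval_fps_X_mult fps_conv_radius_add_less
  fps_conv_radius_deriv_less eval_fps_add

text \<open>Differentiating and multiplying by w multiplies the n-th coefficient by n, so the
  recursion with cleared denominators is an identity of formal power series. It can be evaluated at
  w because the step does not shrink the common disc of convergence.\<close>

lemma step_ode:
  fixes p \<psi> :: real and w :: complex and U :: "2 \<Rightarrow> complex"
    and \<alpha> \<beta> :: "nat \<Rightarrow> real" and P :: "real ^ 2 ^ 2"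
  assumes "nonresonant p"
    and w: "norm w < fps_conv_radius (cfps \<alpha>)" "norm w < fps_conv_radius (cfps \<beta>)"
  defines "U \<equiv> \<lambda>j. P $ 1 $ j * pseries \<alpha> w + P $ 2 $ j * pseries \<beta> w"
    and "A \<equiv> cfps (step\<^sub>A p P \<psi> \<alpha> \<beta>)" and "B \<equiv> cfps (step\<^sub>B p P \<alpha> \<beta>)"
  shows "w * eval_fps (fps_deriv B) w + 2 * p * eval_fps B w = w * U 1"
    and "w * eval_fps (fps_deriv A) w + w * U 2 = \<psi> * eval_fps B w"
proof -
  let ?U = "\<lambda>j. fps_const (complex_of_real (P $ 1 $ j)) * cfps \<alpha> + fps_const (complex_of_real (P $ 2 $ j)) * cfps \<beta>"
  have r: "norm w < fps_conv_radius A" "norm w < fps_conv_radius B"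
    unfolding A_def B_def by (rule fps_conv_radius_step; fact w)+
  have "fps_X * fps_deriv B + fps_const (complex_of_real (2 * p)) * B = fps_X * ?U 1"
  proof (rule fps_ext)
    fix n
    show "fps_nth (fps_X * fps_deriv B + fps_const (complex_of_real (2 * p)) * B) n = fps_nth (fps_X * ?U 1) n"
    proof (cases n)
      \<comment> \<open>The right side has no constant term, so 2p times the constant term of
        \<open>B\<close> must vanish: \<open>step\<^sub>B\<close> starts with 0.\<close>
      case 0
      then show ?thesis by (simp add: B_def step\<^sub>B_def)
    next
      case (Suc m)
      with arg_cong [OF step\<^sub>B_Suc [OF assms(1), of m P \<alpha> \<beta>], of complex_of_real] show ?thesis
        by (simp add: B_def algebra_simps)
    qed
  qed
  from arg_cong [OF this, of "\<lambda>f. eval_fps f w"]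
  show "w * eval_fps (fps_deriv B) w + 2 * p * eval_fps B w = w * U 1"
    using w r by (simp add: eval_fps_rules U_def pseries_eq_eval_fps)
  have "fps_X * fps_deriv A + fps_X * ?U 2 = fps_const (complex_of_real \<psi>) * B"
  proof (rule fps_ext)
    fix n
    show "fps_nth (fps_X * fps_deriv A + fps_X * ?U 2) n = fps_nth (fps_const (complex_of_real \<psi>) * B) n"
    proof (cases n)
      case 0
      then show ?thesis by (simp add: B_def step\<^sub>B_def)
    next
      case (Suc m)
      with arg_cong [OF step\<^sub>A_Suc [of m p P \<psi> \<alpha> \<beta>], of complex_of_real] show ?thesis
        by (simp add: A_def B_def algebra_simps)
    qed
  qed
  from arg_cong [OF this, of "\<lambda>f. eval_fps f w"]
  show "w * eval_fps (fps_deriv A) w + w * U 2 = \<psi> * eval_fps B w"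
    using w r by (simp add: eval_fps_rules U_def pseries_eq_eval_fps)
qed

text \<open>A condition on b z suffices: |c z| \<le> |b z| for c in [a, b], so
  \<open>step_ode\<close> holds along the whole segment and the fundamental theorem of calculus
  applies.\<close>

lemma integral_step:
  fixes a b p \<psi> :: real and z :: complex
    and \<alpha> \<beta> :: "nat \<Rightarrow> real" and P :: "real ^ 2 ^ 2"
  assumes "nonresonant p" "0 < a" "a < b"
    and rad: "norm (b * z) < fps_conv_radius (cfps \<alpha>)" "norm (b * z) < fps_conv_radius (cfps \<beta>)"
  defines "A \<equiv> step\<^sub>A p P \<psi> \<alpha> \<beta>" and "B \<equiv> step\<^sub>B p P \<alpha> \<beta>"
  shows "z *s integral {a..b} (\<lambda>c. AB p \<psi> \<alpha> \<beta> c z v* cmat (H p P \<psi> c)) =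
    AB p \<psi> A B b z v* cmat J - AB p \<psi> A B a z v* cmat J"
proof (cases "z = 0")
  \<comment> \<open>At z = 0 the starting values of the step make the J-vector equal to (0, -1) at a
    as well as at b, so both sides are 0.\<close>
  case True
  then show ?thesis
    using assms by (simp add: AB_J A_def B_def step\<^sub>A_def step\<^sub>B_def vec2_eq_iff)
next
  case False
  define U :: "2 \<Rightarrow> real \<Rightarrow> complex" where
    "U j c = P $ 1 $ j * pseries \<alpha> (c * z) + P $ 2 $ j * pseries \<beta> (c * z)" for j c
  \<comment> \<open>\<open>f1\<close>, \<open>f2\<close> are the components of the integrand by
    \<open>AB_H\<close>; \<open>F1\<close>, \<open>F2\<close> are those of the J-vector after the
    step by \<open>AB_J\<close>.\<close>
  define f1 where "f1 c = of_real (c powr (2 * p)) * U 1 c" for c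
  define f2 where "f2 c = of_real (shear p \<psi> c) * U 1 c + U 2 c" for c
  define F1 where "F1 c = of_real (c powr (2 * p)) * pseries B (of_real c * z)" for c
  define F2 where "F2 c = of_real (shear p \<psi> c) * pseries B (of_real c * z) - pseries A (of_real c * z)" for c
  have deriv: "(F1 has_vector_derivative z * f1 c) (at c)" "(F2 has_vector_derivative z * f2 c) (at c)"
    if c: "a \<le> c" "c \<le> b" for c
  proof -
    have "c > 0" using c \<open>0 < a\<close> by simp
    have "norm (of_real c * z) \<le> norm (of_real b * z)"
      using c \<open>c > 0\<close> by (auto simp: norm_mult intro!: mult_right_mono)
    then have w: "norm (of_real c * z) < fps_conv_radius (cfps \<alpha>)" "norm (of_real c * z) < fps_conv_radius (cfps \<beta>)"
      using rad by (auto intro: le_less_trans [rotated])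
    let ?A' = "eval_fps (fps_deriv (cfps A)) (of_real c * z)" and ?B' = "eval_fps (fps_deriv (cfps B)) (of_real c * z)"
    let ?A = "pseries A (of_real c * z)" and ?B = "pseries B (of_real c * z)"
    let ?q = "complex_of_real (c powr (2 * p))" and ?r = "complex_of_real (shear p \<psi> c)"
    have inner: "((\<lambda>c. of_real c * z) has_vector_derivative z) (at c)"
      by (auto intro!: derivative_eq_intros)
    have dA: "((\<lambda>c. pseries A (of_real c * z)) has_vector_derivative z * ?A') (at c)"
      using field_vector_diff_chain_at [OF inner has_field_derivative_eval_fps]
        fps_conv_radius_step(1) [OF w] by (simp add: A_def pseries_eq_eval_fps o_def)
    have dB: "((\<lambda>c. pseries B (of_real c * z)) has_vector_derivative z * ?B') (at c)"
      using field_vector_diff_chain_at [OF inner has_field_derivative_eval_fps]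
        fps_conv_radius_step(2) [OF w] by (simp add: B_def pseries_eq_eval_fps o_def)
    have "((\<lambda>c. c powr (2 * p)) has_real_derivative 2 * p * c powr (2 * p) / c) (at c)"
      using \<open>c > 0\<close> by (auto intro!: derivative_eq_intros simp: powr_diff)
    from has_vector_derivative_of_real [OF this, where ?'a = complex]
    have dq: "((\<lambda>c. of_real (c powr (2 * p))) has_vector_derivative 2 * p * ?q / c) (at c)"
      by simp
    have dr: "((\<lambda>c. of_real (shear p \<psi> c)) has_vector_derivative \<psi> * ?q / c) (at c)"
      using has_vector_derivative_of_real [OF shear_deriv [OF \<open>c > 0\<close>, of p \<psi>], where ?'a = complex] by simp
    have ode1: "of_real c * z * ?B' + 2 * p * ?B = of_real c * z * U 1 c"
      using step_ode(1) [OF assms(1) w] by (simp add: U_def B_def pseries_eq_eval_fps)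
    have ode2: "of_real c * z * ?A' + of_real c * z * U 2 c = \<psi> * ?B"
      using step_ode(2) [OF assms(1) w] by (simp add: U_def B_def A_def pseries_eq_eval_fps)
    have shear: "2 * complex_of_real p * ?r = \<psi> * ?q - \<psi>"
      using arg_cong [OF two_p_shear [OF \<open>c > 0\<close>, of p \<psi>], of complex_of_real] by simp
    have c0: "complex_of_real c \<noteq> 0" using \<open>c > 0\<close> by simp
    \<comment> \<open>Multiplied by c, the derivative of \<open>F1\<close> from the product rule
      becomes c^(2p) times the left side of \<open>ode1\<close>.\<close>
    have "of_real c * (?q * (z * ?B') + 2 * p * ?q / c * ?B) = of_real c * (z * f1 c)"
      using c0 arg_cong [OF ode1, of "\<lambda>x. ?q * x"] by (simp add: f1_def algebra_simps)
    then have "?q * (z * ?B') + 2 * p * ?q / c * ?B = z * f1 c" using c0 by simp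
    with has_vector_derivative_mult [OF dq dB] show "(F1 has_vector_derivative z * f1 c) (at c)"
      by (simp add: F1_def [abs_def])
    \<comment> \<open>The same for \<open>F2\<close>: c z B' is eliminated by \<open>ode1\<close>
      and c z A' by \<open>ode2\<close>.\<close>
    have "of_real c * (?r * (z * ?B') + \<psi> * ?q / c * ?B - z * ?A')
        = ?r * (of_real c * z * ?B') + \<psi> * ?q * ?B - of_real c * z * ?A'"
      using c0 by (simp add: algebra_simps)
    also have "\<dots> = ?r * (of_real c * z * U 1 c - 2 * p * ?B) + \<psi> * ?q * ?B - (\<psi> * ?B - of_real c * z * U 2 c)"
      unfolding ode1 [symmetric] ode2 [symmetric] by simp
    \<comment> \<open>What is left over is a multiple of \<open>?B\<close> whose coefficient is 0 by
      \<open>shear\<close>.\<close>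
    also have "\<dots> = of_real c * (z * f2 c) - ((2 * p * ?r) - (\<psi> * ?q - \<psi>)) * ?B"
      by (simp add: f2_def algebra_simps)
    finally have "?r * (z * ?B') + \<psi> * ?q / c * ?B - z * ?A' = z * f2 c"
      using c0 shear by simp
    with has_vector_derivative_diff [OF has_vector_derivative_mult [OF dr dB] dA]
    show "(F2 has_vector_derivative z * f2 c) (at c)"
      by (simp add: F2_def [abs_def])
  qed
  have ftc: "(f has_integral (F b - F a) / z) {a..b}"
    if "\<And>c. a \<le> c \<Longrightarrow> c \<le> b \<Longrightarrow> (F has_vector_derivative z * f c) (at c)" for f F
  proof -
    have "((\<lambda>c. z * f c) has_integral F b - F a) {a..b}"
      using \<open>a < b\<close> that by (intro fundamental_theorem_of_calculus) (auto intro: has_vector_derivative_at_within)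
    from has_integral_mult_right [OF this, of "1 / z"] show ?thesis
      using False by simp
  qed
  have "((\<lambda>c. vector [f1 c, f2 c] :: complex ^ 2) has_integral
      vector [(F1 b - F1 a) / z, (F2 b - F2 a) / z]) {a..b}"
    by (intro has_integral_vector2 ftc deriv)
  moreover have "integral {a..b} (\<lambda>c. AB p \<psi> \<alpha> \<beta> c z v* cmat (H p P \<psi> c)) = integral {a..b} (\<lambda>c. vector [f1 c, f2 c])"
    using \<open>0 < a\<close> by (intro integral_cong) (simp add: AB_H f1_def f2_def U_def)
  ultimately have "integral {a..b} (\<lambda>c. AB p \<psi> \<alpha> \<beta> c z v* cmat (H p P \<psi> c)) =
      vector [(F1 b - F1 a) / z, (F2 b - F2 a) / z]"
    by (simp add: integral_unique)
  then show ?thesis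
    using False assms(2,3) by (simp add: AB_J F1_def F2_def vec2_eq_iff)
qed

section \<open>Comparison of coefficients of dilated power series\<close>

lemma eventually_dilation_less:
  fixes R :: ereal
  assumes "0 < R"
  shows "\<forall>\<^sub>F z :: complex in nhds 0. norm (of_real c * z) < R"
proof -
  obtain e where e: "0 < e" "ereal e < R"
    using ereal_dense2 [OF assms] by (auto simp: zero_ereal_def)
  have "((\<lambda>z :: complex. norm (of_real c * z)) \<longlongrightarrow> norm (of_real c * (0 :: complex))) (nhds 0)"
    by (intro tendsto_intros filterlim_ident)
  then have "\<forall>\<^sub>F z :: complex in nhds 0. norm (of_real c * z) < e"
    using e(1) by (intro order_tendstoD) auto
  then show ?thesis
  proof eventually_elim
    case (elim z)
    then have "ereal (norm (of_real c * z)) < ereal e" by simp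
    also note e(2)
    finally show ?case .
  qed
qed

text \<open>The combination of the two dilations is itself a power series in z, with coefficients (x
  b^n - y a^n) \<gamma> n, so the identity theorem applies.\<close>

lemma dilation_coeffs_eq_0:
  assumes rad: "fps_conv_radius (cfps \<gamma>) > 0"
    and ev: "\<forall>\<^sub>F z in nhds 0. complex_of_real x * pseries \<gamma> (of_real b * z) - of_real y * pseries \<gamma> (of_real a * z) = 0"
  shows "(x * b ^ n - y * a ^ n) * \<gamma> n = 0"
proof -
  define \<delta> where "\<delta> n = (x * b ^ n - y * a ^ n) * \<gamma> n" for n
  have small: "\<forall>\<^sub>F z in nhds 0. (\<lambda>n. complex_of_real (\<delta> n) * z ^ n) sums 0"
    using ev eventually_dilation_less [OF rad, of a] eventually_dilation_less [OF rad, of b]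
  proof eventually_elim
    case (elim z)
    have "complex_of_real x * (\<gamma> n * (of_real b * z) ^ n) - of_real y * (\<gamma> n * (of_real a * z) ^ n)
        = \<delta> n * z ^ n" for n
      by (simp add: \<delta>_def power_mult_distrib left_diff_distrib)
    moreover have "(\<lambda>n. complex_of_real x * (\<gamma> n * (of_real b * z) ^ n) - of_real y * (\<gamma> n * (of_real a * z) ^ n)) sums
        (of_real x * pseries \<gamma> (of_real b * z) - of_real y * pseries \<gamma> (of_real a * z))"
      using sums_eval_fps [OF elim(2)] sums_eval_fps [OF elim(3)]
      by (intro sums_diff sums_mult) (simp_all add: pseries_eq_eval_fps)
    ultimately show ?case
      using elim(1) by (simp only:)
  qed
  then obtain e where e: "e > 0" "\<And>z. dist z 0 < e \<Longrightarrow> (\<lambda>n. complex_of_real (\<delta> n) * z ^ n) sums 0"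
    unfolding eventually_nhds_metric by auto
  \<comment> \<open>The identity theorem requires a positive radius for \<delta>; convergence at the
    single point e/2 provides it.\<close>
  have "0 < ereal (norm (complex_of_real (e / 2)))"
    using e(1) by simp
  also have "ereal (norm (complex_of_real (e / 2))) \<le> fps_conv_radius (cfps \<delta>)"
    unfolding fps_conv_radius_def fps_nth_Abs_fps
    by (intro conv_radius_geI sums_summable [OF e(2)]) (use e(1) in simp)
  finally have "fps_conv_radius (cfps \<delta>) > 0" .
  moreover have "\<forall>\<^sub>F z in nhds 0. eval_fps (cfps \<delta>) z = eval_fps 0 z"
    using small by eventually_elim (auto simp: eval_fps_def dest: sums_unique)
  ultimately have "cfps \<delta> = 0"
    by (intro eval_fps_eqD [of "cfps \<delta>" 0]) simp_all
  from arg_cong [OF this, of "\<lambda>f. fps_nth f n"] have "\<delta> n = 0" by simp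
  then show ?thesis unfolding \<delta>_def .
qed

lemma pseries_diff:
  assumes "norm w < fps_conv_radius (cfps \<alpha>)" "norm w < fps_conv_radius (cfps \<alpha>')"
  shows "pseries (\<lambda>n. \<alpha> n - \<alpha>' n) w = pseries \<alpha> w - pseries \<alpha>' w"
proof -
  have "cfps (\<lambda>n. \<alpha> n - \<alpha>' n) = cfps \<alpha> - cfps \<alpha>'"
    by (rule fps_ext) simp
  with assms show ?thesis by (simp add: pseries_eq_eval_fps eval_fps_diff)
qed

lemma fps_conv_radius_cfps_diff:
  assumes "fps_conv_radius (cfps \<alpha>) > 0" "fps_conv_radius (cfps \<alpha>') > 0"
  shows "fps_conv_radius (cfps (\<lambda>n. \<alpha> n - \<alpha>' n)) > 0"
proof -
  have "cfps (\<lambda>n. \<alpha> n - \<alpha>' n) = cfps \<alpha> - cfps \<alpha>'"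
    by (rule fps_ext) simp
  with assms show ?thesis
    using less_le_trans [OF _ fps_conv_radius_diff, of 0 "cfps \<alpha>" "cfps \<alpha>'"] by simp
qed

lemma dilation_eq_imp_coeff_eq:
  assumes rad: "fps_conv_radius (cfps \<alpha>) > 0" "fps_conv_radius (cfps \<alpha>') > 0"
    and ev: "\<forall>\<^sub>F z in nhds 0.
      complex_of_real x * pseries \<alpha> (of_real b * z) - of_real y * pseries \<alpha> (of_real a * z) =
      complex_of_real x * pseries \<alpha>' (of_real b * z) - of_real y * pseries \<alpha>' (of_real a * z)"
    and nz: "x * b ^ n \<noteq> y * a ^ n"
  shows "\<alpha> n = \<alpha>' n"
proof -
  let ?\<gamma> = "\<lambda>n. \<alpha> n - \<alpha>' n"
  have "\<forall>\<^sub>F z in nhds 0. complex_of_real x * pseries ?\<gamma> (of_real b * z) - of_real y * pseries ?\<gamma> (of_real a * z) = 0"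
    using ev eventually_dilation_less [OF rad(1), of a] eventually_dilation_less [OF rad(1), of b]
      eventually_dilation_less [OF rad(2), of a] eventually_dilation_less [OF rad(2), of b]
    by eventually_elim (simp add: pseries_diff algebra_simps)
  from dilation_coeffs_eq_0 [OF fps_conv_radius_cfps_diff [OF rad] this, of n] nz
  show ?thesis by simp
qed

text \<open>The system is triangular: by \<open>AB_J\<close> the first component contains only
  \<beta>, the second \<alpha> and a shear multiple of \<beta>. At index 0 the weights at a and b
  agree for \<alpha>, and for \<beta> if p = 0, so the initial values enter as hypotheses.\<close>

lemma AB_J_increment_inj:
  assumes "nonresonant p" and ab: "0 < a" "a < b"
    and rad: "fps_conv_radius (cfps \<alpha>) > 0" "fps_conv_radius (cfps \<beta>) > 0"
      "fps_conv_radius (cfps \<alpha>') > 0" "fps_conv_radius (cfps \<beta>') > 0"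
    and init: "\<alpha> 0 = \<alpha>' 0" "\<beta> 0 = \<beta>' 0"
    and ev: "\<forall>\<^sub>F z in nhds 0. AB p \<psi> \<alpha> \<beta> b z v* cmat J - AB p \<psi> \<alpha> \<beta> a z v* cmat J =
      AB p \<psi> \<alpha>' \<beta>' b z v* cmat J - AB p \<psi> \<alpha>' \<beta>' a z v* cmat J"
  shows "\<alpha> = \<alpha>'" "\<beta> = \<beta>'"
proof -
  have "0 < b" using ab by simp
  have \<beta>: "\<beta> n = \<beta>' n" for n
  proof (cases n)
    case 0
    then show ?thesis using init by simp
  next
    case (Suc m)
    have nz: "2 * p + real n \<noteq> 0"
      using assms(1) Suc unfolding nonresonant_def by blast
    \<comment> \<open>Taken through exp, these are b^(2p+n) and a^(2p+n); ln and exp are injective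
      and 2p + n is nonzero.\<close>
    have "(2 * p + real n) * ln b \<noteq> (2 * p + real n) * ln a"
      using nz ab by simp
    moreover have "x powr (2 * p) * x ^ n = exp ((2 * p + real n) * ln x)" if "x > 0" for x :: real
      using that by (simp add: powr_def distrib_right exp_add exp_of_nat_mult)
    ultimately have "b powr (2 * p) * b ^ n \<noteq> a powr (2 * p) * a ^ n"
      using ab \<open>0 < b\<close> by (simp del: mult_cancel_left)
    moreover have "\<forall>\<^sub>F z in nhds 0.
        complex_of_real (b powr (2 * p)) * pseries \<beta> (of_real b * z) - of_real (a powr (2 * p)) * pseries \<beta> (of_real a * z) =
        complex_of_real (b powr (2 * p)) * pseries \<beta>' (of_real b * z) - of_real (a powr (2 * p)) * pseries \<beta>' (of_real a * z)"
      using ev by eventually_elim (use ab \<open>0 < b\<close> in \<open>simp add: AB_J vec2_eq_iff\<close>)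
    ultimately show ?thesis
      using rad by (intro dilation_eq_imp_coeff_eq [of \<beta> \<beta>'])
  qed
  then show "\<beta> = \<beta>'" ..
  have "\<alpha> n = \<alpha>' n" for n
  proof (cases n)
    case 0
    then show ?thesis using init by simp
  next
    case (Suc m)
    have "a ^ n < b ^ n"
      using ab Suc by (intro power_strict_mono) auto
    then have "1 * b ^ n \<noteq> 1 * a ^ n" by simp
    \<comment> \<open>Since \<beta> = \<beta>' is known, the shear terms of the second component
      cancel.\<close>
    moreover have "\<forall>\<^sub>F z in nhds 0.
        complex_of_real 1 * pseries \<alpha> (of_real b * z) - of_real 1 * pseries \<alpha> (of_real a * z) =
        complex_of_real 1 * pseries \<alpha>' (of_real b * z) - of_real 1 * pseries \<alpha>' (of_real a * z)"
      using ev by eventually_elim (use ab \<open>0 < b\<close> in \<open>simp add: AB_J vec2_eq_iff \<open>\<beta> = \<beta>'\<close> algebra_simps\<close>)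
    ultimately show ?thesis
      using rad by (intro dilation_eq_imp_coeff_eq [of \<alpha> \<alpha>'])
  qed
  then show "\<alpha> = \<alpha>'" ..
qed

section \<open>The cycle of implications from (i) to (ii) to (iii) and back to (i)\<close>

theorem theorem3p1:
  fixes p \<psi> :: real and P :: "real ^ 2 ^ 2" and \<alpha> \<beta> :: "nat \<Rightarrow> real"
  assumes "p \<notin> {- (real k / 2) | k. k \<ge> 1}"
  defines "i \<equiv>
      (\<alpha> 0, \<beta> 0) = (1, 0) \<and>
      (\<forall>n. (vector [\<alpha> (n + 1), \<beta> (n + 1)] :: real ^ 2) =
        vector [\<alpha> n, \<beta> n] v*
          ((- 1 / ((real n + 1) * (2 * p + real n + 1))) *\<^sub>R
            (P ** J ** mat22 (2 * p + real n + 1) 0 \<psi> (real n + 1))))"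
    and "ii \<equiv>
      represents_entire \<alpha> \<and> represents_entire \<beta> \<and>
      pseries \<alpha> 0 = 1 \<and> pseries \<beta> 0 = 0 \<and>
      (\<forall>a b z. 0 < a \<and> a < b \<longrightarrow> integral_eq p P \<psi> \<alpha> \<beta> a b z)"
    and "iii \<equiv>
      conv_radius (\<lambda>n. complex_of_real (\<alpha> n)) > 0 \<and>
      conv_radius (\<lambda>n. complex_of_real (\<beta> n)) > 0 \<and>
      pseries \<alpha> 0 = 1 \<and> pseries \<beta> 0 = 0 \<and>
      (\<exists>a b. 0 < a \<and> a < b \<and> (\<forall>\<^sub>F z in nhds 0. integral_eq p P \<psi> \<alpha> \<beta> a b z))"
  shows "(i \<longleftrightarrow> ii) \<and> (ii \<longleftrightarrow> iii)"
proof -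
  have p: "nonresonant p" by (rule nonresonantI [OF assms(1)])
  note i_iff = recursion_iff [OF p, where \<alpha> = \<alpha> and \<beta> = \<beta> and P = P and \<psi> = \<psi>, folded i_def]
  have "ii" if "i"
  proof -
    have fixed: "\<alpha> = step\<^sub>A p P \<psi> \<alpha> \<beta>" "\<beta> = step\<^sub>B p P \<alpha> \<beta>"
      using that unfolding i_iff by blast+
    note entire = represents_entire_fixed_point [OF fixed]
    \<comment> \<open>At a fixed point the increment found by \<open>integral_step\<close> is that
      of (\<alpha>, \<beta>) itself.\<close>
    have "integral_eq p P \<psi> \<alpha> \<beta> a b z" if "0 < a" "a < b" for a b z
      unfolding integral_eq_def
      using integral_step [OF p that, where z = z and \<alpha> = \<alpha> and \<beta> = \<beta> and P = P and \<psi> = \<psi>] entire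
      by (simp add: fixed [symmetric] represents_entire_iff)
    moreover have "\<alpha> 0 = 1" "\<beta> 0 = 0"
      using that unfolding i_def by simp_all
    ultimately show ii
      using entire unfolding ii_def by simp
  qed
  moreover have "iii" if "ii"
  proof -
    have "integral_eq p P \<psi> \<alpha> \<beta> 1 2 z" for z
      using that unfolding ii_def by simp
    then have "\<exists>a b. 0 < a \<and> a < b \<and> (\<forall>\<^sub>F z in nhds 0. integral_eq p P \<psi> \<alpha> \<beta> a b z)"
      by (intro exI [of _ 1] exI [of _ 2]) simp
    with that show iii
      unfolding ii_def iii_def represents_entire_iff by (simp add: fps_conv_radius_def)
  qed
  moreover have "i" if "iii"
  proof -
    let ?A = "step\<^sub>A p P \<psi> \<alpha> \<beta>" and ?B = "step\<^sub>B p P \<alpha> \<beta>"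
    have rad: "fps_conv_radius (cfps \<alpha>) > 0" "fps_conv_radius (cfps \<beta>) > 0"
      using that unfolding iii_def fps_conv_radius_def by simp_all
    \<comment> \<open>Positivity of a radius is the case w = 0 of
      \<open>fps_conv_radius_step\<close>.\<close>
    then have rad': "fps_conv_radius (cfps ?A) > 0" "fps_conv_radius (cfps ?B) > 0"
      using fps_conv_radius_step [of 0 \<alpha> \<beta>] by (simp_all add: zero_ereal_def)
    have init: "\<alpha> 0 = ?A 0" "\<beta> 0 = ?B 0"
      using that unfolding iii_def by (simp_all add: step\<^sub>A_def step\<^sub>B_def)
    from that obtain a b where ab: "0 < a" "a < b" and ev: "\<forall>\<^sub>F z in nhds 0. integral_eq p P \<psi> \<alpha> \<beta> a b z"
      unfolding iii_def by blast
    \<comment> \<open>For z near 0 the point b z lies in both discs, so \<open>integral_step\<close>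
      turns the integral side into the increment after one step.\<close>
    have "\<forall>\<^sub>F z in nhds 0. AB p \<psi> \<alpha> \<beta> b z v* cmat J - AB p \<psi> \<alpha> \<beta> a z v* cmat J =
        AB p \<psi> ?A ?B b z v* cmat J - AB p \<psi> ?A ?B a z v* cmat J"
      using ev eventually_dilation_less [OF rad(1), of b] eventually_dilation_less [OF rad(2), of b]
      by eventually_elim (simp add: integral_eq_def integral_step [OF p ab])
    from AB_J_increment_inj [OF p ab rad rad' init this] show i
      unfolding i_iff by blast
  qed
  ultimately show ?thesis by blast
qed

end
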